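(* Let $\mathcal{A}$ be a finite alphabet, let $\Omega,X\subseteq\mathcal{A}^{\mathbb{N}}$ be subshifts and let $p\ge2$ be an integer. The entropy of the axial product of $X_\Omega^p$ and $X$ on the $2$-tree is $$h^T\left(X_\Omega^p\times X\right)=\sum_{k=0}^\infty\ \sum_{\substack{i>1\\ p\nmid i}}\frac{1}{2^{k+i+1}}\log\left|\mathcal{P}\left(\Delta_k^{(i,1)},\Omega\times X\right)\right|,$$ where $\Delta_k^{(i,1)}$ is taken with respect to the multiplicative constraint $p$ on the left.
   Context: $\mathbb{N}=\{1,2,\dots\}$. A subshift is a closed shift-invariant subset of $\mathcal{A}^{\mathbb{N}}$. The multiplicative subshift is $X_\Omega^p=\{x\in\mathcal{A}^{\mathbb{N}}:(x_{ip^l})_{l=0}^\infty\in\Omega\text{ for all }i\in\mathbb{N}\text{ with }p\nmid i\}$. $T^2$ is the free semigroup with unit $\epsilon$ generated by $f_1,f_2$; $|g|$ is the word length of $g\in T^2$, and $\Delta_n=\{g\in T^2:|g|\le n\}$. For $g\ne\epsilon$, $e(g)$ is the last letter of $g$ (for $g=\epsilon$ there is no last letter, so $f_i\ne e(\epsilon)$ for both $i$). Axial products on $T^2$: a sequence $(y_j)_{j\ge0}$ is regarded as an element of $\mathcal{A}^{\mathbb{N}}$ whose $(j+1)$-st entry is $y_j$. $X_\Omega^p\times X$ is the set of $x\in\mathcal{A}^{T^2}$ such that $(x_{gf_1^j})_{j=0}^\infty\in X_\Omega^p$ for every $g\in T^2$ with $e(g)\ne f_1$, and $(x_{gf_2^j})_{j=0}^\infty\in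 X$ for every $g\in T^2$. $\Omega\times X$ is the set of $x\in\mathcal{A}^{T^2}$ such that $(x_{gf_1^j})_{j=0}^\infty\in\Omega$ and $(x_{gf_2^j})_{j=0}^\infty\in X$ for every $g\in T^2$. For finite $\Lambda\subseteq T^2$ and $Z\subseteq\mathcal{A}^{T^2}$, $\mathcal{P}(\Lambda,Z)=\{(x_g)_{g\in\Lambda}:x\in Z\}$, and the entropy is $h^T(Z)=\lim_{n\to\infty}\frac{\log|\mathcal{P}(\Delta_n,Z)|}{|\Delta_n|}$. Types: for $g\in T^2$ and $m\in\{1,2\}$ let $\tau_m(g)=1+\max\{a\ge0:g\text{ ends in }f_m^a\}$; $g$ has type $(\tau_1(g),\tau_2(g))$. Dependence sets (constraint $p$ on the left): for $h\in T^2$ put $s_1(h)=hf_1^{(p-1)\tau_1(h)}$ and $s_2(h)=hf_2$. Let $g$ be a vertex of type $(i,1)$ and $k\ge0$. The vertices of $g\Delta_k$ dependent on $g$ are the vertices $s_{u_n}\circ\cdots\circ s_{u_1}(g)$, $n\ge0$, $u_1,\dots,u_n\in\{1,2\}$, of length at most $|g|+k$. The reshaped set $\Delta_k^{(i,1)}\subseteq T^2$ is the set of all words $f_{u_1}\cdots f_{u_n}$ ($n\ge0$) such that $|s_{u_n}\circ\cdots\circ s_{u_1}(g)|\le|g|+k$; it depends only on $i,k,p$. *)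

theory Defs
  imports "HOL-Analysis.Analysis"
begin

text \<open>
  An element \<open>x\<close> of \<open>\<A>\<close> to the power \<open>{1,2,\<dots>}\<close> is represented by the function
  \<open>y :: nat \<Rightarrow> 'a\<close> with \<open>y j = x (j + 1)\<close>, so the entry at position \<open>n \<ge> 1\<close> is \<open>y (n - 1)\<close>.
\<close>

definition subshift :: "(nat \<Rightarrow> 'a) set \<Rightarrow> bool" where
  "subshift X \<longleftrightarrow>
     closedin (product_topology (\<lambda>_. discrete_topology UNIV) UNIV) X \<and>
     (\<forall>y\<in>X. (\<lambda>j. y (Suc j)) \<in> X)"

definition mult_subshift :: "nat \<Rightarrow> (nat \<Rightarrow> 'a) set \<Rightarrow> (nat \<Rightarrow> 'a) set" where
  "mult_subshift p \<Omega> = {y. \<forall>i\<ge>1. \<not> p dvd i \<longrightarrow> (\<lambda>l. y (i * p ^ l - 1)) \<in> \<Omega>}"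

text \<open>
  The free semigroup with unit on two generators is the set of words over \<open>{F1, F2}\<close>, with
  concatenation as product and \<open>length\<close> as word length.
\<close>

datatype gen = F1 | F2

type_synonym tree = "gen list"

definition ball_T :: "nat \<Rightarrow> tree set" where
  "ball_T n = {g. length g \<le> n}"

definition mult_axial_product ::
    "nat \<Rightarrow> (nat \<Rightarrow> 'a) set \<Rightarrow> (nat \<Rightarrow> 'a) set \<Rightarrow> (tree \<Rightarrow> 'a) set" where
  "mult_axial_product p \<Omega> X =
     {x. (\<forall>g. g = [] \<or> last g \<noteq> F1 \<longrightarrow> (\<lambda>j. x (g @ replicate j F1)) \<in> mult_subshift p \<Omega>) \<and>
         (\<forall>g. (\<lambda>j. x (g @ replicate j F2)) \<in> X)}"

definition axial_product ::
    "(nat \<Rightarrow> 'a) set \<Rightarrow> (nat \<Rightarrow> 'a) set \<Rightarrow> (tree \<Rightarrow> 'a) set" where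
  "axial_product \<Omega> X =
     {x. (\<forall>g. (\<lambda>j. x (g @ replicate j F1)) \<in> \<Omega>) \<and>
         (\<forall>g. (\<lambda>j. x (g @ replicate j F2)) \<in> X)}"

definition patterns :: "tree set \<Rightarrow> (tree \<Rightarrow> 'a) set \<Rightarrow> (tree \<Rightarrow> 'a) set" where
  "patterns \<Lambda> Z = (\<lambda>x. restrict x \<Lambda>) ` Z"

text \<open>
  The logarithm of a (finite) cardinality takes values in \<open>ereal\<close>, so that an empty \<open>Z\<close> gets
  entropy \<open>-\<infinity>\<close> rather than the value suggested by \<open>ln 0 = 0\<close>.
\<close>

definition log_card :: "'b set \<Rightarrow> ereal" where
  "log_card S = (if S = {} then -\<infinity> else ereal (ln (real (card S))))"

definition entropy_seq :: "(tree \<Rightarrow> 'a) set \<Rightarrow> nat \<Rightarrow> ereal" where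
  "entropy_seq Z n = log_card (patterns (ball_T n) Z) / ereal (real (card (ball_T n)))"

definition tree_entropy :: "(tree \<Rightarrow> 'a) set \<Rightarrow> ereal" where
  "tree_entropy Z = lim (entropy_seq Z)"

definition tau :: "gen \<Rightarrow> tree \<Rightarrow> nat" where
  "tau m g = 1 + Max {a. \<exists>h. g = h @ replicate a m}"

definition vtype :: "tree \<Rightarrow> nat \<times> nat" where
  "vtype g = (tau F1 g, tau F2 g)"

fun dep_succ :: "nat \<Rightarrow> gen \<Rightarrow> tree \<Rightarrow> tree" where
  "dep_succ p F1 h = h @ replicate ((p - 1) * tau F1 h) F1"
| "dep_succ p F2 h = h @ [F2]"

text \<open>
  \<open>fold (dep_succ p) [u\<^sub>1, \<dots>, u\<^sub>n] g\<close> applies the letter \<open>u\<^sub>1\<close> first and \<open>u\<^sub>n\<close> last.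
\<close>

definition reshaped_at :: "nat \<Rightarrow> tree \<Rightarrow> nat \<Rightarrow> tree set" where
  "reshaped_at p g k = {u. length (fold (dep_succ p) u g) \<le> length g + k}"

text \<open>
  By \<open>reshaped_eq\<close> below, the set does not depend on the vertex of type \<open>(i, 1)\<close>.
\<close>

definition reshaped :: "nat \<Rightarrow> nat \<Rightarrow> nat \<Rightarrow> tree set" where
  "reshaped p i k = (\<Union>g \<in> {g. vtype g = (i, 1)}. reshaped_at p g k)"

lemma tau_eq: "tau m g = Suc (length (takeWhile (\<lambda>u. u = m) (rev g)))"
proof -
  let ?t = "length (takeWhile (\<lambda>u. u = m) (rev g))"
  have iff: "(\<exists>h. g = h @ replicate a m) \<longleftrightarrow> a \<le> ?t" for a
  proof
    assume "\<exists>h. g = h @ replicate a m"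
    then obtain h where "g = h @ replicate a m" by blast
    then have "rev g = replicate a m @ rev h" by simp
    then show "a \<le> ?t" by (simp add: takeWhile_append)
  next
    assume a: "a \<le> ?t"
    have *: "takeWhile (\<lambda>u. u = m) (rev g) = replicate ?t m"
      by (rule replicate_length_same[symmetric]) (auto dest: set_takeWhileD)
    have "take a (rev g) = take a (takeWhile (\<lambda>u. u = m) (rev g))"
      using a by (metis append_take_drop_id takeWhile_eq_take take_take min.absorb1)
    also have "\<dots> = replicate a m"
      using a by (subst *) (simp add: min_absorb1)
    finally have "rev g = replicate a m @ drop a (rev g)"
      by (metis append_take_drop_id)
    then have "g = rev (drop a (rev g)) @ replicate a m"
      by (metis rev_append rev_replicate rev_rev_ident)
    then show "\<exists>h. g = h @ replicate a m" by blast
  qed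
  have "{a. \<exists>h. g = h @ replicate a m} = {..?t}"
    using iff by auto
  moreover have "Max {..?t} = ?t"
    by (rule Max_eqI) auto
  ultimately show ?thesis by (simp add: tau_def)
qed

lemma reshaped_at_cong:
  assumes "tau F1 g = tau F1 g'"
  shows "reshaped_at p g k = reshaped_at p g' k"
proof -
  have append1: "tau F1 (h @ replicate n F1) = tau F1 h + n" for h n
    by (simp add: tau_eq takeWhile_append)
  have "int (length (fold (dep_succ p) u g)) - int (length g) =
        int (length (fold (dep_succ p) u g')) - int (length g')" for u
    using assms
  proof (induction u arbitrary: g g')
    case (Cons m u)
    have "tau F1 (dep_succ p m g) = tau F1 (dep_succ p m g')"
      using Cons.prems by (cases m) (simp_all add: append1, simp add: tau_eq)
    from Cons.IH[OF this] show ?case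
      using Cons.prems by (cases m) (simp_all add: algebra_simps)
  qed simp
  then have "length (fold (dep_succ p) u g) \<le> length g + k \<longleftrightarrow>
        length (fold (dep_succ p) u g') \<le> length g' + k" for u
    by (smt (verit) of_nat_add of_nat_le_iff)
  then show ?thesis by (simp add: reshaped_at_def)
qed

lemma reshaped_eq:
  assumes "vtype g = (i, 1)"
  shows "reshaped p i k = reshaped_at p g k"
proof -
  have "reshaped_at p g' k = reshaped_at p g k" if "vtype g' = (i, 1)" for g'
    using that assms by (intro reshaped_at_cong) (simp add: vtype_def)
  then show ?thesis using assms unfolding reshaped_def by blast
qed

end

theory Submission
  imports Defs
begin

text \<open>
  Every vertex has at most one predecessor under \<open>s\<^sub>1, s\<^sub>2\<close>, so the tree splits into dependency
  components, each a copy of the whole tree generated by a vertex without predecessor: the unit, or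
  a vertex of type \<open>(i, 1)\<close> with \<open>i > 1\<close> and \<open>\<not> p dvd i\<close>. A configuration lies in the
  multiplicative axial product iff its pullback along each component lies in the axial product, with
  no condition linking different components. Hence the patterns on the ball of radius \<open>n\<close> form a
  product, over the roots \<open>g\<close> of type \<open>(i, 1)\<close> in the ball, of patterns on the reshaped sets with
  parameters \<open>i\<close> and \<open>k = n - length g\<close>. Such roots make up a proportion tending to
  \<open>1 / 2 ^ (k + i + 1)\<close> of the ball, and dominated convergence gives the formula. The dominating
  series \<open>\<Sum> |reshaped p i k| / 2 ^ (k + i + 1)\<close> converges by Fatou, since the components
  partition the ball; the same convergence makes the component of the unit negligible.
\<close>

subsection \<open>Dependency components\<close>

lemma tau_pos: "tau m g > 0"
  by (simp add: tau_eq)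

lemma tau_eq_1: "g = [] \<or> last g \<noteq> m \<Longrightarrow> tau m g = 1"
  by (cases g rule: rev_cases) (simp_all add: tau_eq)

lemma tau_append_replicate: "tau m (h @ replicate n m) = tau m h + n"
  by (simp add: tau_eq takeWhile_append)

lemma tau_split:
  obtains b where "h = b @ replicate (tau m h - 1) m" "b = [] \<or> last b \<noteq> m"
proof -
  let ?t = "length (takeWhile (\<lambda>u. u = m) (rev h))"
  have *: "takeWhile (\<lambda>u. u = m) (rev h) = replicate ?t m"
    by (rule replicate_length_same[symmetric]) (auto dest: set_takeWhileD)
  define b where "b = rev (dropWhile (\<lambda>u. u = m) (rev h))"
  have "rev h = replicate ?t m @ rev b"
    using takeWhile_dropWhile_id[of "\<lambda>u. u = m" "rev h"] * unfolding b_def by simp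
  then have "h = b @ replicate ?t m"
    by (metis rev_append rev_replicate rev_rev_ident)
  then have 1: "h = b @ replicate (tau m h - 1) m" by (simp add: tau_eq)
  have 2: "b = [] \<or> last b \<noteq> m"
    using hd_dropWhile[of "\<lambda>u. u = m" "rev h"] unfolding b_def
    by (auto simp: last_rev)
  show ?thesis using that 1 2 by blast
qed

lemma length_ge_tau: "length g \<ge> tau m g - 1"
  by (metis tau_split length_append length_replicate le_add2)

text \<open>\<open>tau F1\<close> is the position on an \<open>F1\<close>-ray counted from 1, the
  index used in \<open>mult_subshift\<close>. A dependence step along \<open>F1\<close> is thus
  multiplication of the position by \<open>p\<close>.\<close>

lemma tau_dep_succ_F1: "p \<ge> 1 \<Longrightarrow> tau F1 (dep_succ p F1 h) = p * tau F1 h"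
  by (simp add: tau_append_replicate algebra_simps flip: add_mult_distrib)

lemma tau_snoc_F2: "tau F1 (h @ [F2]) = 1"
  by (simp add: tau_eq)

lemma dep_succ_neq_Nil: "p \<ge> 2 \<Longrightarrow> dep_succ p m h \<noteq> []"
  using tau_pos[of F1 h] by (cases m) auto

lemma last_dep_succ: "p \<ge> 2 \<Longrightarrow> last (dep_succ p m h) = m"
  using tau_pos[of F1 h] by (cases m) auto

text \<open>The last letter reveals which successor was taken. For \<open>F1\<close>, dividing the
  new position by \<open>p\<close> then recovers the length of the appended run.\<close>

lemma dep_succ_inject:
  assumes "p \<ge> 2" "dep_succ p m h = dep_succ p m' h'"
  shows "m = m' \<and> h = h'"
proof -
  have m: "m' = m" using last_dep_succ[OF assms(1)] assms(2) by metis
  show ?thesis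
  proof (cases m)
    case F1
    have "p * tau F1 h = p * tau F1 h'"
      using tau_dep_succ_F1[of p] assms F1 m by (metis One_nat_def le_trans one_le_numeral)
    then have "tau F1 h = tau F1 h'" using assms(1) by simp
    then show ?thesis using assms(2) m F1 by simp
  qed (use assms m in auto)
qed

lemma fold_dep_succ_F2: "fold (dep_succ p) (replicate j F2) h = h @ replicate j F2"
  by (induction j arbitrary: h) (auto simp: replicate_append_same)

lemma fold_dep_succ_F1:
  assumes "p \<ge> 1"
  shows "fold (dep_succ p) (replicate j F1) h = h @ replicate ((p ^ j - 1) * tau F1 h) F1"
proof (induction j arbitrary: h)
  case (Suc j)
  \<comment> \<open>Writing \<open>p\<close> and \<open>p ^ j\<close> as successors removes the
    truncated subtractions.\<close>
  obtain q where q: "p = Suc q" using assms by (cases p) auto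
  obtain r where r: "p ^ j = Suc r" using assms by (cases "p ^ j") auto
  have "fold (dep_succ p) (replicate (Suc j) F1) h =
      fold (dep_succ p) (replicate j F1) (dep_succ p F1 h)" by simp
  also have "\<dots> = dep_succ p F1 h @ replicate ((p ^ j - 1) * (p * tau F1 h)) F1"
    by (simp only: Suc.IH tau_dep_succ_F1[OF assms])
  also have "\<dots> = h @ replicate ((p - 1) * tau F1 h + (p ^ j - 1) * (p * tau F1 h)) F1"
    by (simp add: replicate_add)
  also have "(p - 1) * tau F1 h + (p ^ j - 1) * (p * tau F1 h) = (p ^ Suc j - 1) * tau F1 h"
    by (simp only: power_Suc r) (simp add: q algebra_simps)
  finally show ?case .
qed simp

text \<open>The vertices without predecessor: a word ending in \<open>F2\<close> comes from its
  \<open>butlast\<close>, and one ending in \<open>F1\<close> at a position divisible by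
  \<open>p\<close> from the quotient position. The unit is listed separately because
  \<open>last []\<close> is unspecified.\<close>

definition dep_roots :: "nat \<Rightarrow> tree set" where
  "dep_roots p = {g. g = [] \<or> last g = F1 \<and> \<not> p dvd tau F1 g}"

lemma dep_succ_not_root: "p \<ge> 2 \<Longrightarrow> dep_succ p m h \<notin> dep_roots p"
  using last_dep_succ[of p m h] dep_succ_neq_Nil[of p m h] tau_dep_succ_F1[of p h]
  by (cases m) (auto simp: dep_roots_def simp del: dep_succ.simps)

lemma root_or_dep_succ:
  assumes "p \<ge> 2"
  shows "h \<in> dep_roots p \<or> (\<exists>m h'. h = dep_succ p m h')"
proof (cases "h \<in> dep_roots p")
  case False
  show ?thesis
  proof (cases "last h")
    case F1
    with False have d: "p dvd tau F1 h" by (simp add: dep_roots_def)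
    then obtain t where t: "tau F1 h = p * t" by blast
    have t0: "t > 0" using t tau_pos[of F1 h] by (cases t) auto
    obtain b where b: "h = b @ replicate (tau F1 h - 1) F1" "b = [] \<or> last b \<noteq> F1"
      by (rule tau_split)
    \<comment> \<open>The predecessor lies on the same \<open>F1\<close>-ray at position
      \<open>t\<close>; counting from 1 makes its run \<open>t - 1\<close> long.\<close>
    define h' where "h' = b @ replicate (t - 1) F1"
    have th: "tau F1 h' = t"
      using tau_eq_1[OF b(2)] t0 by (simp add: h'_def tau_append_replicate)
    obtain q where q: "p = Suc q" using assms by (cases p) auto
    have "dep_succ p F1 h' = b @ replicate ((t - 1) + (p - 1) * t) F1"
      by (simp add: th replicate_add) (simp add: h'_def)
    also have "(t - 1) + (p - 1) * t = tau F1 h - 1"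
      using t0 by (simp add: t q)
    finally have "h = dep_succ p F1 h'" using b(1) by simp
    then show ?thesis by blast
  next
    case F2
    have "h = dep_succ p F2 (butlast h)"
      using F2 False append_butlast_last_id[of h] by (auto simp: dep_roots_def)
    then show ?thesis by blast
  qed
qed simp

lemma root_fold_exists:
  assumes "p \<ge> 2"
  shows "\<exists>g\<in>dep_roots p. \<exists>u. h = fold (dep_succ p) u g"
proof (induction "length h" arbitrary: h rule: less_induct)
  case less
  show ?case
  proof (cases "h \<in> dep_roots p")
    case True
    then show ?thesis by (intro bexI[of _ h] exI[of _ "[]"]) auto
  next
    case False
    then obtain m h' where h: "h = dep_succ p m h'"
      using root_or_dep_succ[OF assms] by blast
    have "length h' < length h" using h assms tau_pos[of F1 h'] by (cases m) auto
    then obtain g u where "g \<in> dep_roots p" "h' = fold (dep_succ p) u g"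
      using less by blast
    then show ?thesis using h by (intro bexI[of _ g] exI[of _ "u @ [m]"]) auto
  qed
qed

text \<open>Walking backwards is forced: predecessors are unique, and the walk stops exactly at a
  root because no successor is a root.\<close>

lemma root_fold_unique:
  assumes "p \<ge> 2" "g \<in> dep_roots p" "g' \<in> dep_roots p"
    and "fold (dep_succ p) u g = fold (dep_succ p) u' g'"
  shows "g = g' \<and> u = u'"
  using assms(4)
proof (induction u arbitrary: u' rule: rev_induct)
  case Nil
  then show ?case using dep_succ_not_root[OF assms(1)] assms(2)
    by (cases u' rule: rev_cases) auto
next
  case (snoc m u)
  show ?case
  proof (cases u' rule: rev_cases)
    case Nil
    then show ?thesis using snoc.prems dep_succ_not_root[OF assms(1)] assms(3) by auto
  next
    case (snoc v m')
    then show ?thesis using snoc.prems dep_succ_inject[OF assms(1)] snoc.IH by fastforce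
  qed
qed

lemma length_fold_dep_succ:
  assumes "p \<ge> 2"
  shows "length (fold (dep_succ p) u g) \<ge> length g + length u"
proof (induction u arbitrary: g)
  case (Cons m u)
  have "length (dep_succ p m g) \<ge> Suc (length g)"
    using assms tau_pos[of F1 g] by (cases m) (auto simp: Suc_le_eq)
  then show ?case using Cons[of "dep_succ p m g"] by simp
qed simp

lemma finite_gen: "finite (UNIV :: gen set)"
proof -
  have "UNIV = {F1, F2}" using gen.exhaust by auto
  then show ?thesis by (metis finite.emptyI finite_insert)
qed

lemma finite_words_le: "finite {u :: gen list. length u \<le> n}"
  using finite_lists_length_le[of "UNIV :: gen set" n] by (simp add: finite_gen)

lemma finite_reshaped_at:
  assumes "p \<ge> 2"
  shows "finite (reshaped_at p g k)"
proof (rule finite_subset[OF _ finite_words_le])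
  show "reshaped_at p g k \<subseteq> {u. length u \<le> k}"
  proof
    fix u assume "u \<in> reshaped_at p g k"
    then show "u \<in> {u. length u \<le> k}"
      using length_fold_dep_succ[OF assms, of g u] by (simp add: reshaped_at_def)
  qed
qed

text \<open>The components partition the ball. Lengths grow along a component, so the root of a
  vertex of the ball lies in the ball, and truncating its component at length \<open>n\<close>
  leaves the budget \<open>n - length g\<close>.\<close>

lemma bij_betw_fold_dep_succ:
  assumes "p \<ge> 2"
  shows "bij_betw (\<lambda>(g, u). fold (dep_succ p) u g)
    (SIGMA g:{g\<in>dep_roots p. length g \<le> n}. reshaped_at p g (n - length g)) (ball_T n)"
proof (rule bij_betwI')
  fix x y
  assume "x \<in> (SIGMA g:{g\<in>dep_roots p. length g \<le> n}. reshaped_at p g (n - length g))"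
    "y \<in> (SIGMA g:{g\<in>dep_roots p. length g \<le> n}. reshaped_at p g (n - length g))"
  then show "((case x of (g, u) \<Rightarrow> fold (dep_succ p) u g) =
      (case y of (g, u) \<Rightarrow> fold (dep_succ p) u g)) = (x = y)"
    using root_fold_unique[OF assms] by (auto split: prod.splits)
next
  fix x
  assume "x \<in> (SIGMA g:{g\<in>dep_roots p. length g \<le> n}. reshaped_at p g (n - length g))"
  then show "(case x of (g, u) \<Rightarrow> fold (dep_succ p) u g) \<in> ball_T n"
    by (auto simp: reshaped_at_def ball_T_def)
next
  fix h assume h: "h \<in> ball_T n"
  obtain g u where gu: "g \<in> dep_roots p" "h = fold (dep_succ p) u g"
    using root_fold_exists[OF assms] by blast
  have "length g \<le> n"
    using length_fold_dep_succ[OF assms, of g u] gu h by (simp add: ball_T_def)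
  then show "\<exists>x\<in>(SIGMA g:{g\<in>dep_roots p. length g \<le> n}. reshaped_at p g (n - length g)).
      h = (case x of (g, u) \<Rightarrow> fold (dep_succ p) u g)"
    using gu h by (intro bexI[of _ "(g, u)"]) (auto simp: reshaped_at_def ball_T_def)
qed

section \<open>Splitting and gluing configurations along components\<close>

lemma subshift_shift:
  assumes "subshift \<Omega>" "y \<in> \<Omega>"
  shows "(\<lambda>j. y (j + l)) \<in> \<Omega>"
proof (induction l)
  case (Suc l)
  then show ?case using assms(1) by (auto simp: subshift_def)
qed (use assms in simp)

text \<open>A vertex at position \<open>i * p ^ l\<close> with \<open>i\<close> not divisible by
  \<open>p\<close> is followed along \<open>F1\<close> by the positions
  \<open>i * p ^ (l + j)\<close>. These entries are the \<open>l\<close>-fold shift of a point of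
  \<open>\<Omega>\<close>, hence again in \<open>\<Omega>\<close>.\<close>

lemma mult_axial_product_imp_axial:
  assumes "subshift \<Omega>" "p \<ge> 2" "x \<in> mult_axial_product p \<Omega> X"
  shows "(\<lambda>u. x (fold (dep_succ p) u h)) \<in> axial_product \<Omega> X"
proof -
  have "(\<lambda>j. x (fold (dep_succ p) (g @ replicate j F2) h)) \<in> X" for g
    using assms(3) by (simp add: fold_dep_succ_F2 mult_axial_product_def del: fold_replicate)
  moreover have "(\<lambda>j. x (fold (dep_succ p) (g @ replicate j F1) h)) \<in> \<Omega>" for g
  proof -
    define k where "k = fold (dep_succ p) g h"
    define t where "t = tau F1 k"
    obtain b where b: "k = b @ replicate (t - 1) F1" "b = [] \<or> last b \<noteq> F1"
      unfolding t_def by (rule tau_split)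
    have t: "t > 0" unfolding t_def by (rule tau_pos)
    then obtain i l where il: "\<not> p dvd i" "t = i * p ^ l"
    proof -
      have "\<exists>q l. t = q * p ^ l \<and> \<not> p dvd q" using t
      proof (induction t rule: less_induct)
        case (less t)
        show ?case
        proof (cases "p dvd t")
          case True
          then obtain s where s: "t = p * s" by blast
          have "s < t" "s > 0" using s less.prems assms(2) by auto
          from less.IH[OF this] obtain q l where "s = q * p ^ l" "\<not> p dvd q" by blast
          then show ?thesis using s by (intro exI[of _ q] exI[of _ "Suc l"]) auto
        next
          case False
          then show ?thesis by (intro exI[of _ t] exI[of _ 0]) auto
        qed
      qed
      then show ?thesis using that by blast
    qed
    have i: "i \<ge> 1" using il by (cases i) auto
    have "(\<lambda>j. x (b @ replicate j F1)) \<in> mult_subshift p \<Omega>"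
      using assms(3) b(2) by (auto simp: mult_axial_product_def)
    then have "(\<lambda>j. x (b @ replicate (i * p ^ j - 1) F1)) \<in> \<Omega>"
      using i il(1) by (simp add: mult_subshift_def)
    from subshift_shift[OF assms(1) this, of l]
    have *: "(\<lambda>j. x (b @ replicate (i * p ^ (j + l) - 1) F1)) \<in> \<Omega>" .
    have "fold (dep_succ p) (g @ replicate j F1) h = b @ replicate (i * p ^ (j + l) - 1) F1" for j
    proof -
      have "fold (dep_succ p) (g @ replicate j F1) h = k @ replicate ((p ^ j - 1) * t) F1"
        using assms(2) by (simp add: fold_dep_succ_F1 k_def t_def del: fold_replicate)
      also have "\<dots> = b @ replicate ((t - 1) + (p ^ j - 1) * t) F1"
        by (simp add: b(1) replicate_add)
      also have "(t - 1) + (p ^ j - 1) * t = p ^ j * t - 1"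
        using t assms(2) by (cases "p ^ j") auto
      finally show ?thesis by (simp add: il(2) power_add ac_simps)
    qed
    then show ?thesis using * by simp
  qed
  ultimately show ?thesis unfolding axial_product_def by simp
qed

text \<open>Every sequence constrained in the multiplicative product, an \<open>F2\<close>-ray or
  the positions \<open>i * p ^ j\<close> of an \<open>F1\<close>-ray, runs inside a single
  component.\<close>

lemma mult_axial_productI:
  assumes "p \<ge> 2"
    and "\<And>g. g \<in> dep_roots p \<Longrightarrow> (\<lambda>u. x (fold (dep_succ p) u g)) \<in> axial_product \<Omega> X"
  shows "x \<in> mult_axial_product p \<Omega> X"
  unfolding mult_axial_product_def mult_subshift_def
proof (intro CollectI conjI allI impI)
  fix h
  obtain g u where gu: "g \<in> dep_roots p" "h = fold (dep_succ p) u g"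
    using root_fold_exists[OF assms(1)] by blast
  have "(\<lambda>j. x (fold (dep_succ p) (u @ replicate j F2) g)) \<in> X"
    using assms(2)[OF gu(1)] by (simp add: axial_product_def)
  then show "(\<lambda>j. x (h @ replicate j F2)) \<in> X"
    by (simp add: gu(2) fold_dep_succ_F2 del: fold_replicate)
next
  fix b i
  assume b: "b = [] \<or> last b \<noteq> F1" and i: "1 \<le> i" and "\<not> p dvd i"
  \<comment> \<open>The vertex at position \<open>i\<close> starts the constrained sequence. For
    \<open>i > 1\<close> it is a root, but for \<open>i = 1\<close> it may end in \<open>F2\<close>,
    so it is in general reached from a root by a word \<open>u\<close>.\<close>
  define h where "h = b @ replicate (i - 1) F1"
  have tau: "tau F1 h = i" using i tau_eq_1[OF b] by (simp add: h_def tau_append_replicate)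
  obtain g u where gu: "g \<in> dep_roots p" "h = fold (dep_succ p) u g"
    using root_fold_exists[OF assms(1)] by blast
  have *: "(\<lambda>j. x (fold (dep_succ p) (u @ replicate j F1) g)) \<in> \<Omega>"
    using assms(2)[OF gu(1)] by (simp add: axial_product_def)
  have "fold (dep_succ p) (u @ replicate j F1) g = b @ replicate (i * p ^ j - 1) F1" for j
  proof -
    have "fold (dep_succ p) (u @ replicate j F1) g = h @ replicate ((p ^ j - 1) * i) F1"
      using assms(1) by (simp add: fold_dep_succ_F1 gu(2)[symmetric] tau del: fold_replicate)
    also have "\<dots> = b @ replicate ((i - 1) + (p ^ j - 1) * i) F1"
      by (simp add: h_def replicate_add)
    also have "(i - 1) + (p ^ j - 1) * i = i * p ^ j - 1"
      using i assms(1) by (cases "p ^ j") (auto simp: mult.commute)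
    finally show ?thesis .
  qed
  then show "(\<lambda>l. x (b @ replicate (i * p ^ l - 1) F1)) \<in> \<Omega>" using * by simp
qed

text \<open>Configurations on different components can be chosen independently, since each vertex
  determines its root and its word.\<close>

lemma glue_mult_axial_product:
  assumes "p \<ge> 2" and "\<And>g. g \<in> dep_roots p \<Longrightarrow> y g \<in> axial_product \<Omega> X"
  obtains x where "x \<in> mult_axial_product p \<Omega> X"
    "\<And>g u. g \<in> dep_roots p \<Longrightarrow> x (fold (dep_succ p) u g) = y g u"
proof -
  define x where "x h = (THE a. \<exists>g\<in>dep_roots p. \<exists>u. h = fold (dep_succ p) u g \<and> a = y g u)" for h
  have *: "x (fold (dep_succ p) u g) = y g u" if "g \<in> dep_roots p" for g u
    unfolding x_def
  proof (rule the_equality)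
    fix a
    assume "\<exists>g'\<in>dep_roots p. \<exists>u'. fold (dep_succ p) u g = fold (dep_succ p) u' g' \<and> a = y g' u'"
    then show "a = y g u" using root_fold_unique[OF assms(1) that] by blast
  qed (use that in blast)
  show ?thesis
    by (rule that[OF mult_axial_productI[OF assms(1)] *]) (simp add: * assms(2))
qed

lemma finite_patterns:
  fixes Z :: "(tree \<Rightarrow> 'a::finite) set"
  assumes "finite \<Lambda>"
  shows "finite (patterns \<Lambda> Z)"
proof (rule finite_subset)
  show "patterns \<Lambda> Z \<subseteq> PiE \<Lambda> (\<lambda>_. UNIV)" by (auto simp: patterns_def)
qed (use assms in \<open>simp add: finite_PiE\<close>)

text \<open>Injectivity holds because the components cover the ball, surjectivity because extensions
  chosen separately for each root can be glued.\<close>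

lemma bij_betw_patterns_mult_axial_product:
  fixes \<Omega> X :: "(nat \<Rightarrow> 'a) set"
  assumes "subshift \<Omega>" "p \<ge> 2" "axial_product \<Omega> X \<noteq> {}"
  defines "R \<equiv> \<lambda>n. {g\<in>dep_roots p. length g \<le> n}"
  shows "bij_betw (\<lambda>f. \<lambda>g\<in>R n. \<lambda>u\<in>reshaped_at p g (n - length g). f (fold (dep_succ p) u g))
    (patterns (ball_T n) (mult_axial_product p \<Omega> X))
    (\<Pi>\<^sub>E g\<in>R n. patterns (reshaped_at p g (n - length g)) (axial_product \<Omega> X))"
    (is "bij_betw ?\<Phi> ?P ?Q")
proof -
  have mem: "fold (dep_succ p) u g \<in> ball_T n"
    if "g \<in> R n" "u \<in> reshaped_at p g (n - length g)" for g u
    using that by (auto simp: R_def reshaped_at_def ball_T_def)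
  have im: "?\<Phi> (restrict x (ball_T n)) =
      (\<lambda>g\<in>R n. restrict (\<lambda>u. x (fold (dep_succ p) u g)) (reshaped_at p g (n - length g)))" for x :: "tree \<Rightarrow> 'a"
    using mem by (intro restrict_ext) auto
  have "inj_on ?\<Phi> ?P"
  proof (rule inj_onI)
    fix f f' assume f: "f \<in> ?P" and f': "f' \<in> ?P" and eq: "?\<Phi> f = ?\<Phi> f'"
    have "f h = f' h" if h: "h \<in> ball_T n" for h
    proof -
      have "h \<in> (\<lambda>(g, u). fold (dep_succ p) u g) `
          (SIGMA g:{g\<in>dep_roots p. length g \<le> n}. reshaped_at p g (n - length g))"
        using bij_betw_fold_dep_succ[OF assms(2), of n] h unfolding bij_betw_def by blast
      then obtain g u where gu: "g \<in> R n" "u \<in> reshaped_at p g (n - length g)"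
        "h = fold (dep_succ p) u g" by (auto simp: R_def)
      then show ?thesis using fun_cong[OF fun_cong[OF eq], of g u] by simp
    qed
    moreover have "f h = f' h" if "h \<notin> ball_T n" for h
      using f f' that by (auto simp: patterns_def)
    ultimately show "f = f'" by blast
  qed
  moreover have "?\<Phi> ` ?P \<subseteq> ?Q"
    using mult_axial_product_imp_axial[OF assms(1,2)]
    unfolding patterns_def image_image im
    by (auto simp del: PiE_restrict)
  moreover have "?Q \<subseteq> ?\<Phi> ` ?P"
  proof
    fix q assume q: "q \<in> ?Q"
    \<comment> \<open>Gluing asks for a configuration at every root; \<open>y0\<close> is the
      default for roots outside the ball.\<close>
    obtain y0 where y0: "y0 \<in> axial_product \<Omega> X" using assms(3) by blast
    have "\<forall>g. \<exists>y. y \<in> axial_product \<Omega> X \<and>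
        (g \<in> R n \<longrightarrow> q g = restrict y (reshaped_at p g (n - length g)))"
    proof
      fix g
      show "\<exists>y. y \<in> axial_product \<Omega> X \<and>
        (g \<in> R n \<longrightarrow> q g = restrict y (reshaped_at p g (n - length g)))"
      proof (cases "g \<in> R n")
        case True
        then have "q g \<in> patterns (reshaped_at p g (n - length g)) (axial_product \<Omega> X)"
          using q by auto
        then show ?thesis by (auto simp: patterns_def)
      qed (use y0 in auto)
    qed
    then obtain y where y: "\<And>g. y g \<in> axial_product \<Omega> X"
      "\<And>g. g \<in> R n \<Longrightarrow> q g = restrict (y g) (reshaped_at p g (n - length g))" by metis
    obtain x where x: "x \<in> mult_axial_product p \<Omega> X"
      "\<And>g u. g \<in> dep_roots p \<Longrightarrow> x (fold (dep_succ p) u g) = y g u"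
      by (rule glue_mult_axial_product[OF assms(2), of y]) (use y in auto)
    have "q = ?\<Phi> (restrict x (ball_T n))"
    proof
      fix g
      show "q g = ?\<Phi> (restrict x (ball_T n)) g"
      proof (cases "g \<in> R n")
        case True
        then have "g \<in> dep_roots p" by (simp add: R_def)
        then show ?thesis unfolding im using True y(2) x(2) by simp
      next
        case False
        then show ?thesis using q unfolding im by (auto simp: PiE_def extensional_def)
      qed
    qed
    then show "q \<in> ?\<Phi> ` ?P" using x(1) unfolding patterns_def by blast
  qed
  ultimately show ?thesis unfolding bij_betw_def by blast
qed

lemma finite_dep_roots_le: "finite {g\<in>dep_roots p. length g \<le> n}"
  by (rule finite_subset[OF _ finite_words_le[of n]]) auto

lemma reshaped_at_root:
  assumes "g \<in> dep_roots p"
  shows "reshaped_at p g k = reshaped p (tau F1 g) k"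
proof -
  have "tau F2 g = 1" using assms by (intro tau_eq_1) (auto simp: dep_roots_def)
  then show ?thesis using reshaped_eq[of g "tau F1 g" p k] by (simp add: vtype_def)
qed

subsection \<open>Frequencies of the component roots\<close>

text \<open>Dominated convergence for unordered sums: the Weierstrass M-test makes the finite
  partial sums converge uniformly in \<open>n\<close>, so the two limits may be swapped.\<close>

lemma tendsto_infsum_dominated:
  fixes a :: "'c \<Rightarrow> 'b \<Rightarrow> real"
  assumes g: "g summable_on A"
    and bound: "\<And>n x. x \<in> A \<Longrightarrow> norm (a n x) \<le> g x"
    and lim: "\<And>x. x \<in> A \<Longrightarrow> ((\<lambda>n. a n x) \<longlongrightarrow> b x) F"
    and F: "F \<noteq> bot"
  shows "b summable_on A" "((\<lambda>n. infsum (a n) A) \<longlongrightarrow> infsum b A) F"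
proof -
  have b: "norm (b x) \<le> g x" if "x \<in> A" for x
    by (rule tendsto_upperbound[OF tendsto_norm[OF lim[OF that]]]) (use bound that F in auto)
  then show sb: "b summable_on A"
    by (rule Infinite_Sum.abs_summable_summable[OF Infinite_Sum.abs_summable_on_comparison_test'[OF g]])
  show "((\<lambda>n. infsum (a n) A) \<longlongrightarrow> infsum b A) F"
  proof (rule swap_uniform_limit')
    show "(sum b \<longlongrightarrow> infsum b A) (finite_subsets_at_top A)"
      using sb by (rule infsum_tendsto)
    show "\<forall>\<^sub>F K in finite_subsets_at_top A. ((\<lambda>n. \<Sum>x\<in>K. a n x) \<longlongrightarrow> sum b K) F"
      by (rule eventually_finite_subsets_at_top_weakI) (intro tendsto_intros lim, auto)
    show "uniform_limit UNIV (\<lambda>K n. \<Sum>x\<in>K. a n x) (\<lambda>n. infsum (a n) A) (finite_subsets_at_top A)"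
      by (rule Weierstrass_m_test_general[OF _ g]) (use bound in auto)
  qed auto
qed

lemma card_words_length: "card {u :: gen list. length u = n} = 2 ^ n"
proof -
  have "(UNIV :: gen set) = {F1, F2}" using gen.exhaust by auto
  then have "card (UNIV :: gen set) = card {F1, F2}" by (rule arg_cong)
  then have "card (UNIV :: gen set) = 2" by simp
  then show ?thesis using card_lists_length_eq[OF finite_gen, of n] by simp
qed

lemma card_ball_T: "card (ball_T n) = 2 ^ (n + 1) - 1"
proof -
  have "ball_T n = (\<Union>k\<le>n. {u. length u = k})" by (auto simp: ball_T_def)
  also have "card \<dots> = (\<Sum>k\<le>n. card {u :: gen list. length u = k})"
    by (rule card_UN_disjoint) (auto intro: finite_subset[OF _ finite_words_le])
  also have "\<dots> = (\<Sum>k\<le>n. 2 ^ k)" by (simp add: card_words_length)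
  also have "\<dots> = 2 ^ (n + 1) - 1" by (induction n) auto
  finally show ?thesis .
qed

lemma real_card_ball_T: "real (card (ball_T n)) = 2 ^ (n + 1) - 1"
  by (simp add: card_ball_T of_nat_diff)

definition tau_count :: "nat \<Rightarrow> nat \<Rightarrow> nat" where
  "tau_count m i = card {g. length g = m \<and> tau F1 g = i}"

text \<open>For \<open>i \<le> m\<close> the final run of \<open>i - 1\<close> letters
  \<open>F1\<close> is not the whole word, so an \<open>F2\<close> precedes it and
  \<open>m - i\<close> letters remain free.\<close>

lemma tau_count_ge:
  assumes "1 \<le> i" "i \<le> m"
  shows "tau_count m i = 2 ^ (m - i)"
proof -
  have "{g. length g = m \<and> tau F1 g = i} =
      (\<lambda>w. w @ F2 # replicate (i - 1) F1) ` {w. length w = m - i}" (is "?A = ?f ` ?B")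
  proof (intro equalityI subsetI)
    fix g assume g: "g \<in> ?A"
    obtain b where b: "g = b @ replicate (i - 1) F1" "b = [] \<or> last b \<noteq> F1"
      using tau_split[of g F1] g by auto
    have len: "length b = m - i + 1" using g b(1) assms by auto
    then have "b \<noteq> []" by auto
    moreover from this have "last b = F2" using b(2) by (cases "last b") auto
    ultimately have "b = butlast b @ [F2]" by (metis append_butlast_last_id)
    then have "g = ?f (butlast b)" using b(1) by (metis append_Cons append_Nil append_assoc)
    moreover have "butlast b \<in> ?B" using len by simp
    ultimately show "g \<in> ?f ` ?B" by blast
  next
    fix g assume "g \<in> ?f ` ?B"
    then obtain w where "g = (w @ [F2]) @ replicate (i - 1) F1" "length w = m - i" by auto
    then show "g \<in> ?A" using assms tau_append_replicate[of F1 "w @ [F2]" "i - 1"]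
      by (auto simp: tau_snoc_F2)
  qed
  then have "tau_count m i = card ?B"
    unfolding tau_count_def by (simp add: card_image inj_on_def)
  then show ?thesis by (simp add: card_words_length)
qed

lemma tau_count_eq_0:
  assumes "Suc m < i"
  shows "tau_count m i = 0"
proof -
  have "tau F1 g \<noteq> i" if "length g = m" for g
    using length_ge_tau[of F1 g] that assms by linarith
  then have "{g. length g = m \<and> tau F1 g = i} = {}" by blast
  then show ?thesis by (simp only: tau_count_def card.empty)
qed

lemma tau_count_Suc: "tau_count m (Suc m) \<le> 1"
proof -
  have "{g. length g = m \<and> tau F1 g = Suc m} \<subseteq> {replicate m F1}"
  proof
    fix g assume "g \<in> {g. length g = m \<and> tau F1 g = Suc m}"
    then have g: "length g = m" "tau F1 g = Suc m" by auto
    obtain b where "g = b @ replicate m F1" using tau_split[of g F1] g by auto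
    then show "g \<in> {replicate m F1}" using g by simp
  qed
  from card_mono[OF _ this] show ?thesis by (simp add: tau_count_def)
qed

text \<open>The factor 2 covers \<open>i = Suc m\<close>, where the count is at most 1 although
  \<open>2 ^ m / 2 ^ i\<close> is only one half.\<close>

lemma tau_count_bound:
  assumes "1 \<le> i"
  shows "real (tau_count m i) \<le> 2 * 2 ^ m / 2 ^ i"
proof (cases "i \<le> m")
  case True
  then show ?thesis using assms by (simp add: tau_count_ge field_simps flip: power_add)
next
  case False
  then show ?thesis using tau_count_Suc[of m] tau_count_eq_0[of m i] by (cases "i = Suc m") auto
qed

text \<open>Vertices are indexed by their distance \<open>k = n - length g\<close> to the boundary of the ball rather
  than by their length, because the frequencies converge as \<open>n\<close> grows only for fixed \<open>k\<close>.\<close>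

definition root_freq :: "nat \<Rightarrow> nat \<times> nat \<Rightarrow> real" where
  "root_freq n = (\<lambda>(k, i). if k \<le> n then real (tau_count (n - k) i) / (2 ^ (n + 1) - 1) else 0)"

lemma root_freq_eq_0: "n < k \<or> n + 1 < i \<Longrightarrow> root_freq n (k, i) = 0"
  by (auto simp: root_freq_def tau_count_eq_0)

lemma ball_denominator: "(2::real) ^ n \<le> 2 ^ (n + 1) - 1"
  by simp

lemma ball_denominator_pos: "(2::real) ^ (n + 1) - 1 > 0"
  using ball_denominator[of n] by (smt (verit) zero_less_power)

lemma root_freq_nonneg: "root_freq n q \<ge> 0"
  using ball_denominator_pos[of n] by (auto simp: root_freq_def split: prod.splits)

text \<open>A bound uniform in \<open>n\<close>, for domination. The 4 is the 2 of
  \<open>tau_count_bound\<close> times another 2 from replacing the ball size by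
  \<open>2 ^ n\<close>.\<close>

lemma root_freq_bound:
  assumes "1 \<le> i"
  shows "root_freq n (k, i) \<le> 4 * (1 / 2 ^ (k + i + 1))"
proof (cases "k \<le> n")
  case True
  have "root_freq n (k, i) = real (tau_count (n - k) i) / (2 ^ (n + 1) - 1)"
    using True by (simp add: root_freq_def)
  also have "\<dots> \<le> (2 * 2 ^ (n - k) / 2 ^ i) / 2 ^ n"
    using ball_denominator[of n] tau_count_bound[OF assms, of "n - k"]
    by (intro frac_le) auto
  also have "\<dots> = 4 * (1 / 2 ^ (k + i + 1))"
    using True by (simp add: power_diff power_add field_simps)
  finally show ?thesis .
qed (simp add: root_freq_def)

lemma ball_ratio_tendsto: "(\<lambda>n. 2 ^ n / (2 ^ (n + 1) - 1 :: real)) \<longlonglongrightarrow> 1 / 2"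
proof -
  have "(\<lambda>n. 1 / (2 - (1 / 2) ^ n :: real)) \<longlonglongrightarrow> 1 / (2 - 0)"
    by (intro tendsto_intros LIMSEQ_power_zero) auto
  moreover have "1 / (2 - (1 / 2) ^ n :: real) = 2 ^ n / (2 ^ (n + 1) - 1)" for n
  proof -
    have "(2 - (1 / 2) ^ n :: real) = (2 ^ (n + 1) - 1) / 2 ^ n"
      by (simp add: field_simps power_one_over)
    then show ?thesis by simp
  qed
  ultimately show ?thesis by simp
qed

text \<open>As soon as \<open>k + i \<le> n\<close> the count is exactly
  \<open>2 ^ (n - k - i)\<close>, so only the ratio of \<open>2 ^ n\<close> to the ball size still
  varies.\<close>

lemma root_freq_tendsto:
  assumes "1 \<le> i"
  shows "(\<lambda>n. root_freq n (k, i)) \<longlonglongrightarrow> 1 / 2 ^ (k + i + 1)"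
proof -
  have "(\<lambda>n. 1 / 2 ^ (k + i) * (2 ^ n / (2 ^ (n + 1) - 1 :: real))) \<longlonglongrightarrow> 1 / 2 ^ (k + i) * (1 / 2)"
    by (intro tendsto_intros ball_ratio_tendsto)
  moreover have "\<forall>\<^sub>F n in sequentially.
      1 / 2 ^ (k + i) * (2 ^ n / (2 ^ (n + 1) - 1 :: real)) = root_freq n (k, i)"
  proof (rule eventually_mono[OF eventually_ge_at_top[of "k + i"]])
    fix n assume n: "k + i \<le> n"
    then have "real (tau_count (n - k) i) = 2 ^ n / 2 ^ (k + i)"
      using assms by (simp add: tau_count_ge flip: power_diff)
    then show "1 / 2 ^ (k + i) * (2 ^ n / (2 ^ (n + 1) - 1 :: real)) = root_freq n (k, i)"
      using n by (simp add: root_freq_def)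
  qed
  ultimately have "(\<lambda>n. root_freq n (k, i)) \<longlonglongrightarrow> 1 / 2 ^ (k + i) * (1 / 2)"
    by (rule Lim_transform_eventually)
  then show ?thesis by (simp add: mult.commute)
qed

abbreviation root_index :: "nat \<Rightarrow> (nat \<times> nat) set" where
  "root_index p \<equiv> UNIV \<times> {i. i > 1 \<and> \<not> p dvd i}"

text \<open>Exact for each \<open>n\<close>: roots are grouped by distance to the boundary and type.
  The unit is split off because its type has \<open>i = 1\<close>, which \<open>root_index\<close>
  excludes.\<close>

lemma sum_dep_roots:
  fixes F :: "nat \<Rightarrow> nat \<Rightarrow> real"
  assumes "p \<ge> 2"
  shows "(\<Sum>g | g \<in> dep_roots p \<and> length g \<le> n. F (tau F1 g) (n - length g)) / (2 ^ (n + 1) - 1) =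
    F 1 n / (2 ^ (n + 1) - 1) + (\<Sum>\<^sub>\<infinity>(k, i)\<in>root_index p. root_freq n (k, i) * F i k)"
proof -
  \<comment> \<open>The finite support of \<open>root_freq n\<close>; \<open>n + 1\<close> is the
    largest \<open>tau F1\<close> of a word of length at most \<open>n\<close>.\<close>
  define T where "T = {..n} \<times> {i. 1 < i \<and> i \<le> n + 1 \<and> \<not> p dvd i}"
  define R where "R = {g\<in>dep_roots p. length g \<le> n}"
  have finR: "finite R" unfolding R_def by (rule finite_dep_roots_le)
  have finT: "finite T" by (simp add: T_def)
  have "[] \<in> R" by (simp add: R_def dep_roots_def)
  have tauR: "tau F1 g > 1 \<and> \<not> p dvd tau F1 g" if "g \<in> R - {[]}" for g
  proof -
    from that have g: "g \<noteq> []" "last g = F1" "\<not> p dvd tau F1 g"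
      by (auto simp: R_def dep_roots_def)
    have "tau F1 (butlast g @ replicate 1 F1) = tau F1 (butlast g) + 1"
      by (rule tau_append_replicate)
    also have "butlast g @ replicate 1 F1 = g" using g append_butlast_last_id[of g] by simp
    finally show ?thesis using tau_pos[of F1 "butlast g"] g by simp
  qed
  have "(\<Sum>g\<in>R - {[]}. F (tau F1 g) (n - length g)) =
      (\<Sum>y\<in>T. \<Sum>g | g \<in> R - {[]} \<and> (n - length g, tau F1 g) = y. F (tau F1 g) (n - length g))"
  proof (rule sum.group[symmetric])
    show "(\<lambda>g. (n - length g, tau F1 g)) ` (R - {[]}) \<subseteq> T"
    proof
      fix y assume "y \<in> (\<lambda>g. (n - length g, tau F1 g)) ` (R - {[]})"
      then obtain g where g: "g \<in> R - {[]}" "y = (n - length g, tau F1 g)" by blast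
      then have "tau F1 g \<le> n + 1" using length_ge_tau[of F1 g] by (auto simp: R_def)
      then show "y \<in> T" using tauR[OF g(1)] g(2) by (simp add: T_def)
    qed
  qed (use finR finT in auto)
  also have "\<dots> = (\<Sum>(k, i)\<in>T. real (tau_count (n - k) i) * F i k)"
  proof (rule sum.cong[OF refl])
    fix y assume y: "y \<in> T"
    obtain k i where ki: "y = (k, i)" by fastforce
    \<comment> \<open>Since \<open>i > 1\<close>, such a word ends in \<open>F1\<close>, and since
      \<open>p\<close> does not divide \<open>i\<close> it is a root, so the fibre consists of all
      words counted by \<open>tau_count\<close>.\<close>
    have "{g. g \<in> R - {[]} \<and> (n - length g, tau F1 g) = y} =
        {g. length g = n - k \<and> tau F1 g = i}"
    proof (intro equalityI subsetI)
      fix g assume g: "g \<in> {g. length g = n - k \<and> tau F1 g = i}"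
      then have "\<not> (g = [] \<or> last g \<noteq> F1)"
        using y ki tau_eq_1[of g F1] by (auto simp: T_def)
      then show "g \<in> {g. g \<in> R - {[]} \<and> (n - length g, tau F1 g) = y}"
        using g y ki by (auto simp: T_def R_def dep_roots_def)
    qed (auto simp: ki R_def)
    moreover have "(\<Sum>g | g \<in> R - {[]} \<and> (n - length g, tau F1 g) = y. F (tau F1 g) (n - length g))
        = (\<Sum>g | g \<in> R - {[]} \<and> (n - length g, tau F1 g) = y. F i k)"
      by (rule sum.cong) (auto simp: ki)
    ultimately show "(\<Sum>g | g \<in> R - {[]} \<and> (n - length g, tau F1 g) = y. F (tau F1 g) (n - length g)) =
        (case y of (k, i) \<Rightarrow> real (tau_count (n - k) i) * F i k)"
      by (simp add: ki tau_count_def)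
  qed
  finally have eq: "(\<Sum>g\<in>R - {[]}. F (tau F1 g) (n - length g)) =
      (\<Sum>(k, i)\<in>T. real (tau_count (n - k) i) * F i k)" .
  have "(\<Sum>\<^sub>\<infinity>(k, i)\<in>root_index p. root_freq n (k, i) * F i k) =
      (\<Sum>\<^sub>\<infinity>(k, i)\<in>T. root_freq n (k, i) * F i k)"
  proof (rule infsum_cong_neutral)
    fix y assume y: "y \<in> root_index p - T"
    obtain k i where ki: "y = (k, i)" by fastforce
    have "root_freq n (k, i) = 0"
      using y ki by (intro root_freq_eq_0) (auto simp: T_def)
    then show "(case y of (k, i) \<Rightarrow> root_freq n (k, i) * F i k) = 0" by (simp add: ki)
  qed (auto simp: T_def)
  also have "\<dots> = (\<Sum>(k, i)\<in>T. root_freq n (k, i) * F i k)" using finT by simp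
  also have "\<dots> = (\<Sum>(k, i)\<in>T. real (tau_count (n - k) i) * F i k) / (2 ^ (n + 1) - 1)"
    unfolding sum_divide_distrib by (rule sum.cong) (auto simp: T_def root_freq_def)
  finally have inf: "(\<Sum>\<^sub>\<infinity>(k, i)\<in>root_index p. root_freq n (k, i) * F i k) =
      (\<Sum>g\<in>R - {[]}. F (tau F1 g) (n - length g)) / (2 ^ (n + 1) - 1)" by (simp add: eq)
  have "(\<Sum>g\<in>R. F (tau F1 g) (n - length g)) =
      F 1 n + (\<Sum>g\<in>R - {[]}. F (tau F1 g) (n - length g))"
    using sum.remove[OF finR \<open>[] \<in> R\<close>, of "\<lambda>g. F (tau F1 g) (n - length g)"]
    by (simp add: tau_eq_1)
  then show ?thesis unfolding inf by (simp add: R_def add_divide_distrib)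
qed

subsection \<open>Sizes of the reshaped sets and entropy\<close>

lemma vtype_replicate: "i \<ge> 1 \<Longrightarrow> vtype (replicate (i - 1) F1) = (i, 1)"
  using tau_append_replicate[of F1 "[]" "i - 1"] tau_eq_1[of "[]" F1]
    tau_eq_1[of "replicate (i - 1) F1" F2]
  by (cases "i = 1") (simp_all add: vtype_def)

lemma finite_reshaped:
  assumes "p \<ge> 2" "i \<ge> 1"
  shows "finite (reshaped p i k)"
  using finite_reshaped_at[OF assms(1)] reshaped_eq[OF vtype_replicate[OF assms(2)]] by simp

lemma sum_card_reshaped:
  assumes "p \<ge> 2"
  shows "(\<Sum>g | g \<in> dep_roots p \<and> length g \<le> n. card (reshaped p (tau F1 g) (n - length g))) =
    card (ball_T n)"
proof -
  have "card (ball_T n) =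
      card (SIGMA g:{g\<in>dep_roots p. length g \<le> n}. reshaped_at p g (n - length g))"
    using bij_betw_same_card[OF bij_betw_fold_dep_succ[OF assms]] by simp
  also have "\<dots> = (\<Sum>g | g \<in> dep_roots p \<and> length g \<le> n. card (reshaped_at p g (n - length g)))"
    by (rule card_SigmaI) (auto intro: finite_dep_roots_le finite_reshaped_at assms)
  also have "\<dots> =
      (\<Sum>g | g \<in> dep_roots p \<and> length g \<le> n. card (reshaped p (tau F1 g) (n - length g)))"
    by (rule sum.cong) (auto simp: reshaped_at_root)
  finally show ?thesis ..
qed

text \<open>A Fatou argument: in every ball the dependency components have total relative size one, so
  no growth estimate for the reshaped sets is needed.\<close>

lemma summable_card_reshaped:
  assumes "p \<ge> 2"
  shows "(\<lambda>(k, i). 1 / 2 ^ (k + i + 1) * real (card (reshaped p i k))) summable_on root_index p"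
    (is "?f summable_on _")
proof (rule nonneg_bdd_above_summable_on)
  show "bdd_above (sum ?f ` {F. F \<subseteq> root_index p \<and> finite F})"
  proof (rule bdd_aboveI2)
    fix F assume "F \<in> {F. F \<subseteq> root_index p \<and> finite F}"
    then have F: "F \<subseteq> root_index p" "finite F" by auto
    let ?a = "\<lambda>n (k, i). root_freq n (k, i) * real (card (reshaped p i k))"
    have "(\<lambda>n. \<Sum>q\<in>F. ?a n q) \<longlonglongrightarrow> sum ?f F"
    proof (rule tendsto_sum)
      fix q assume "q \<in> F"
      then obtain k i where q: "q = (k, i)" "i \<ge> 1" using F by force
      show "(\<lambda>n. ?a n q) \<longlonglongrightarrow> ?f q"
        unfolding q(1) prod.case by (intro tendsto_intros root_freq_tendsto q(2))
    qed
    moreover have "(\<Sum>q\<in>F. ?a n q) \<le> 1" for n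
    proof -
      have supp: "?a n (k, i) = 0" if "i > n + 1 \<or> k > n" for k i
        using that root_freq_eq_0[of n k i] by auto
      have "?a n summable_on root_index p"
      proof (subst summable_on_cong_neutral)
        show "?a n summable_on (root_index p \<inter> ({..n} \<times> {..n + 1}))"
          by (rule summable_on_finite) simp
        fix q assume "q \<in> root_index p - root_index p \<inter> ({..n} \<times> {..n + 1})"
        then obtain k i where "q = (k, i)" "i > n + 1 \<or> k > n" by (cases q) auto
        then show "?a n q = 0" using supp[of i k] by (simp only:)
      qed auto
      then have "(\<Sum>q\<in>F. ?a n q) \<le> (\<Sum>\<^sub>\<infinity>q\<in>root_index p. ?a n q)"
        using F by (intro finite_sum_le_infsum) (auto simp: root_freq_nonneg)
      \<comment> \<open>Adding the share of the unit completes the sum to all components, which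
        together fill the ball.\<close>
      also have "\<dots> \<le> real (card (reshaped p 1 n)) / (2 ^ (n + 1) - 1) + \<dots>"
        using ball_denominator_pos[of n] by simp
      also have "\<dots> = (\<Sum>g | g \<in> dep_roots p \<and> length g \<le> n.
          real (card (reshaped p (tau F1 g) (n - length g)))) / (2 ^ (n + 1) - 1)"
        by (rule sum_dep_roots[OF assms, symmetric])
      also have "\<dots> = real (card (ball_T n)) / (2 ^ (n + 1) - 1)"
        by (simp add: sum_card_reshaped[OF assms] flip: of_nat_sum)
      also have "\<dots> = 1" using ball_denominator_pos[of n] by (simp add: real_card_ball_T)
      finally show ?thesis .
    qed
    ultimately show "sum ?f F \<le> 1" by (blast intro: LIMSEQ_le_const2)
  qed
qed auto

text \<open>The component of the root of the tree sits inside the component of any other dependency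
  root, one step along \<open>F2\<close> further down; so its relative size vanishes by summability.\<close>

lemma card_reshaped_1_le:
  assumes "p \<ge> 2" "i \<ge> 1"
  shows "card (reshaped p 1 k) \<le> card (reshaped p i (Suc k))"
proof -
  let ?g = "replicate (i - 1) F1"
  \<comment> \<open>This vertex need not have type \<open>(1, 1)\<close>, but reshaped sets depend
    only on \<open>tau F1\<close>, which is 1 here as at the unit.\<close>
  have "reshaped p 1 k = reshaped_at p (?g @ [F2]) k"
    using reshaped_eq[OF vtype_replicate[of 1], of p k]
      reshaped_at_cong[of "[]" "?g @ [F2]" p k] tau_eq_1[of "[]" F1]
    by (simp add: tau_snoc_F2)
  then have "Cons F2 ` reshaped p 1 k \<subseteq> reshaped p i (Suc k)"
    by (auto simp: reshaped_eq[OF vtype_replicate[OF assms(2)]] reshaped_at_def)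
  from card_mono[OF finite_reshaped[OF assms] this] show ?thesis
    by (simp add: card_image)
qed

lemma card_reshaped_1_tendsto:
  assumes "p \<ge> 2"
  shows "(\<lambda>n. real (card (reshaped p 1 n)) / (2 ^ (n + 1) - 1)) \<longlonglongrightarrow> 0"
proof -
  \<comment> \<open>An index above 1 that \<open>p\<close> never divides, so that its row of the
    double series is available.\<close>
  let ?i = "p + 1"
  let ?t = "\<lambda>k. 1 / 2 ^ (k + ?i + 1) * real (card (reshaped p ?i k))"
  have p1: "\<not> p dvd ?i" using assms by (subst dvd_add_triv_left_iff) simp
  have "(\<lambda>(k, i). 1 / 2 ^ (k + i + 1) * real (card (reshaped p i k))) summable_on
      (\<lambda>k. (k, ?i)) ` UNIV"
    by (rule summable_on_subset_banach[OF summable_card_reshaped[OF assms]])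
      (use p1 assms in auto)
  then have "?t summable_on UNIV"
    by (subst (asm) summable_on_reindex) (auto simp: inj_on_def o_def)
  then have "?t \<longlonglongrightarrow> 0"
    using summable_on_imp_summable summable_LIMSEQ_zero by blast
  \<comment> \<open>The factor turns the weight \<open>1 / 2 ^ (Suc n + ?i + 1)\<close> into
    \<open>1 / 2 ^ n\<close>.\<close>
  then have "(\<lambda>n. 2 ^ (?i + 2) * ?t (Suc n)) \<longlonglongrightarrow> 2 ^ (?i + 2) * 0"
    by (intro tendsto_mult_left LIMSEQ_Suc)
  then have lim: "(\<lambda>n. 2 ^ (?i + 2) * ?t (Suc n)) \<longlonglongrightarrow> 0" by simp
  show ?thesis
  proof (rule tendsto_sandwich[OF _ _ tendsto_const lim])
    show "\<forall>\<^sub>F n in sequentially. 0 \<le> real (card (reshaped p 1 n)) / (2 ^ (n + 1) - 1)"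
      using ball_denominator_pos by (intro always_eventually allI divide_nonneg_pos) auto
    show "\<forall>\<^sub>F n in sequentially. real (card (reshaped p 1 n)) / (2 ^ (n + 1) - 1)
        \<le> 2 ^ (?i + 2) * ?t (Suc n)"
    proof (intro always_eventually allI)
      fix n
      have "real (card (reshaped p 1 n)) / (2 ^ (n + 1) - 1) \<le>
          real (card (reshaped p ?i (Suc n))) / 2 ^ n"
        using card_reshaped_1_le[OF assms, of ?i n] ball_denominator[of n]
        by (intro frac_le) auto
      also have "\<dots> = 2 ^ (?i + 2) * ?t (Suc n)"
        by (simp add: power_add)
      finally show "real (card (reshaped p 1 n)) / (2 ^ (n + 1) - 1) \<le> 2 ^ (?i + 2) * ?t (Suc n)" .
    qed
  qed
qed

text \<open>The averaging principle behind the formula, to be applied to logarithms of pattern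
  counts. Linear growth in the component size supplies the dominating series and also makes the term
  of the unit vanish.\<close>

lemma dep_roots_average_tendsto:
  fixes F :: "nat \<Rightarrow> nat \<Rightarrow> real"
  assumes p: "p \<ge> 2"
    and F: "\<And>i k. i \<ge> 1 \<Longrightarrow> 0 \<le> F i k \<and> F i k \<le> C * real (card (reshaped p i k))"
  shows "(\<lambda>(k, i). 1 / 2 ^ (k + i + 1) * F i k) summable_on root_index p"
    and "(\<lambda>n. (\<Sum>g | g \<in> dep_roots p \<and> length g \<le> n. F (tau F1 g) (n - length g)) / (2 ^ (n + 1) - 1))
      \<longlonglongrightarrow> (\<Sum>\<^sub>\<infinity>(k, i)\<in>root_index p. 1 / 2 ^ (k + i + 1) * F i k)"
proof -
  let ?a = "\<lambda>n (k, i). root_freq n (k, i) * F i k"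
  let ?g = "\<lambda>q. 4 * C * (case q of (k, i) \<Rightarrow> 1 / 2 ^ (k + i + 1) * real (card (reshaped p i k)))"
  have g: "?g summable_on root_index p"
    by (rule summable_on_cmult_right[OF summable_card_reshaped[OF p]])
  have bound: "norm (?a n q) \<le> ?g q" if qI: "q \<in> root_index p" for n q
  proof -
    obtain k i where q: "q = (k, i)" "i \<ge> 1" using qI by force
    have "norm (?a n q) = root_freq n (k, i) * F i k"
      using F[OF q(2), of k] root_freq_nonneg[of n "(k, i)"] by (simp add: q(1))
    also have "\<dots> \<le> (4 * (1 / 2 ^ (k + i + 1))) * (C * real (card (reshaped p i k)))"
      using F[OF q(2), of k] root_freq_bound[OF q(2), of n k] by (intro mult_mono) auto
    finally show ?thesis by (simp add: q(1) mult_ac)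
  qed
  have lim: "(\<lambda>n. ?a n q) \<longlonglongrightarrow> (case q of (k, i) \<Rightarrow> 1 / 2 ^ (k + i + 1) * F i k)"
    if qI: "q \<in> root_index p" for q
  proof -
    obtain k i where q: "q = (k, i)" "i \<ge> 1" using qI by force
    show ?thesis unfolding q(1) prod.case by (intro tendsto_intros root_freq_tendsto q(2))
  qed
  note dom = tendsto_infsum_dominated[OF g bound lim sequentially_bot]
  show "(\<lambda>(k, i). 1 / 2 ^ (k + i + 1) * F i k) summable_on root_index p"
    by (rule dom(1))
  have "(\<lambda>n. F 1 n / (2 ^ (n + 1) - 1)) \<longlonglongrightarrow> 0"
  proof (rule tendsto_sandwich[OF _ _ tendsto_const])
    show "(\<lambda>n. C * (real (card (reshaped p 1 n)) / (2 ^ (n + 1) - 1))) \<longlonglongrightarrow> 0"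
      by (rule tendsto_mult_right_zero[OF card_reshaped_1_tendsto[OF p]])
    show "\<forall>\<^sub>F n in sequentially. 0 \<le> F 1 n / (2 ^ (n + 1) - 1)"
      using ball_denominator_pos F[of 1]
      by (intro always_eventually allI divide_nonneg_pos) auto
    show "\<forall>\<^sub>F n in sequentially.
        F 1 n / (2 ^ (n + 1) - 1) \<le> C * (real (card (reshaped p 1 n)) / (2 ^ (n + 1) - 1))"
      using ball_denominator_pos F[of 1]
      by (intro always_eventually allI) (simp add: divide_right_mono less_imp_le)
  qed
  from tendsto_add[OF this dom(2)]
  show "(\<lambda>n. (\<Sum>g | g \<in> dep_roots p \<and> length g \<le> n. F (tau F1 g) (n - length g)) / (2 ^ (n + 1) - 1))
      \<longlonglongrightarrow> (\<Sum>\<^sub>\<infinity>(k, i)\<in>root_index p. 1 / 2 ^ (k + i + 1) * F i k)"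
    by (simp only: sum_dep_roots[OF p] add_0_left)
qed

section \<open>Pattern counts and the entropy limit\<close>

lemma card_patterns_bounds:
  fixes Z :: "(tree \<Rightarrow> 'a::finite) set"
  assumes "finite \<Lambda>" "Z \<noteq> {}"
  shows "1 \<le> card (patterns \<Lambda> Z)" "card (patterns \<Lambda> Z) \<le> CARD('a) ^ card \<Lambda>"
proof -
  show "1 \<le> card (patterns \<Lambda> Z)"
    using finite_patterns[OF assms(1), of Z] assms(2)
    by (simp add: Suc_le_eq card_gt_0_iff patterns_def)
  have "card (patterns \<Lambda> Z) \<le> card (PiE \<Lambda> (\<lambda>_. UNIV :: 'a set))"
    by (rule card_mono) (auto simp: patterns_def finite_PiE assms(1))
  then show "card (patterns \<Lambda> Z) \<le> CARD('a) ^ card \<Lambda>"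
    using assms(1) by (simp add: card_PiE)
qed

lemma ln_card_patterns_ball:
  fixes \<Omega> X :: "(nat \<Rightarrow> 'a::finite) set"
  assumes "subshift \<Omega>" "p \<ge> 2" "axial_product \<Omega> X \<noteq> {}"
  shows "ln (real (card (patterns (ball_T n) (mult_axial_product p \<Omega> X)))) =
    (\<Sum>g | g \<in> dep_roots p \<and> length g \<le> n.
      ln (real (card (patterns (reshaped p (tau F1 g) (n - length g)) (axial_product \<Omega> X)))))"
proof -
  have "card (patterns (ball_T n) (mult_axial_product p \<Omega> X)) =
    (\<Prod>g | g \<in> dep_roots p \<and> length g \<le> n.
      card (patterns (reshaped_at p g (n - length g)) (axial_product \<Omega> X)))"
    using bij_betw_same_card[OF bij_betw_patterns_mult_axial_product[OF assms, of n]]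
    by (simp add: card_PiE finite_dep_roots_le)
  also have "\<dots> = (\<Prod>g | g \<in> dep_roots p \<and> length g \<le> n.
      card (patterns (reshaped p (tau F1 g) (n - length g)) (axial_product \<Omega> X)))"
    by (rule prod.cong) (auto simp: reshaped_at_root)
  finally show ?thesis
    using card_patterns_bounds(1)[OF finite_reshaped[OF assms(2)] assms(3)] tau_pos
    by (simp add: ln_prod finite_dep_roots_le Suc_le_eq)
qed

lemma has_sum_ereal: "(f has_sum s) A \<Longrightarrow> ((\<lambda>x. ereal (f x)) has_sum ereal s) A"
  by (rule has_sum_homomorphism) (auto intro: continuous_intros)

text \<open>Every finite partial sum containing a fixed index is already
  \<open>-\<infinity>\<close>; nonemptiness excludes the empty sum 0.\<close>

lemma infsum_minus_infinity:
  fixes f :: "'b \<Rightarrow> ereal"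
  assumes "A \<noteq> {}" "\<And>x. x \<in> A \<Longrightarrow> f x = -\<infinity>"
  shows "infsum f A = -\<infinity>"
proof (rule infsumI)
  obtain a where a: "a \<in> A" using assms(1) by blast
  have "sum f Y = -\<infinity>" if "finite Y" "{a} \<subseteq> Y" "Y \<subseteq> A" for Y
  proof -
    have "sum f Y = f a + sum f (Y - {a})" using that by (simp add: sum.remove)
    moreover have "sum f (Y - {a}) \<noteq> \<infinity>"
      using that assms(2) by (subst sum_Pinfty) auto
    ultimately show ?thesis using assms(2)[OF a] by simp
  qed
  then have "\<forall>\<^sub>F Y in finite_subsets_at_top A. -\<infinity> = sum f Y"
    unfolding eventually_finite_subsets_at_top using a by (intro exI[of _ "{a}"]) auto
  then show "(f has_sum -\<infinity>) A"
    unfolding has_sum_def by (rule Lim_transform_eventually[OF tendsto_const])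
qed

lemma suminf_minus_infinity:
  fixes f :: "nat \<Rightarrow> ereal"
  assumes "\<And>n. f n = -\<infinity>"
  shows "suminf f = -\<infinity>"
proof -
  \<comment> \<open>The partial sums start at \<open>Suc n\<close> because the empty one is
    0.\<close>
  have "sum f {..<Suc n} = -\<infinity>" for n
    by (induction n) (simp_all add: assms)
  then have "(\<lambda>n. sum f {..<Suc n}) \<longlonglongrightarrow> -\<infinity>" by (simp only: tendsto_const)
  then have "f sums -\<infinity>" unfolding sums_def by (rule LIMSEQ_imp_Suc)
  then show ?thesis by (rule sums_unique[symmetric])
qed

theorem theorem3p9:
  fixes \<Omega> X :: "(nat \<Rightarrow> 'a::finite) set" and p :: nat
  assumes "subshift \<Omega>" and "subshift X" and "p \<ge> 2"
  shows "convergent (entropy_seq (mult_axial_product p \<Omega> X)) \<and>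
    tree_entropy (mult_axial_product p \<Omega> X) =
      (\<Sum>k. \<Sum>\<^sub>\<infinity>i\<in>{i. i > 1 \<and> \<not> p dvd i}.
         ereal (1 / 2 ^ (k + i + 1)) * log_card (patterns (reshaped p i k) (axial_product \<Omega> X)))"
    (is "_ \<and> _ = ?rhs")
proof -
  let ?I = "{i. i > 1 \<and> \<not> p dvd i}"
  have "entropy_seq (mult_axial_product p \<Omega> X) \<longlonglongrightarrow> ?rhs"
  proof (cases "axial_product \<Omega> X = {}")
    case True
    have "mult_axial_product p \<Omega> X = {}"
      using mult_axial_product_imp_axial[OF assms(1,3)] True by blast
    moreover have "real (card (ball_T n)) > 0" for n
      using ball_denominator_pos[of n] by (simp only: real_card_ball_T)
    ultimately have "entropy_seq (mult_axial_product p \<Omega> X) = (\<lambda>n. -\<infinity>)"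
      by (intro ext) (simp add: entropy_seq_def patterns_def log_card_def)
    moreover have "?rhs = -\<infinity>"
    proof (intro suminf_minus_infinity infsum_minus_infinity)
      \<comment> \<open>The index \<open>p + 1\<close> keeps the inner sums nonempty, so they equal
        \<open>-\<infinity>\<close> and not 0.\<close>
      have "\<not> p dvd p + 1" using assms(3) by (subst dvd_add_triv_left_iff) simp
      then show "?I \<noteq> {}" using assms(3) by (auto intro!: exI[of _ "p + 1"])
    qed (simp add: True patterns_def log_card_def)
    ultimately show ?thesis by simp
  next
    case False
    define F where "F i k = ln (real (card (patterns (reshaped p i k) (axial_product \<Omega> X))))" for i k
    have F: "0 \<le> F i k \<and> F i k \<le> ln (real CARD('a)) * real (card (reshaped p i k))"
      if "i \<ge> 1" for i k
    proof -
      \<comment> \<open>At least one pattern makes the logarithm nonnegative; at most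
        \<open>CARD('a)\<close> choices per vertex make it linear in the size of the set.\<close>
      note b = card_patterns_bounds[OF finite_reshaped[OF assms(3) that, of k] False]
      have "F i k \<le> ln (real (CARD('a) ^ card (reshaped p i k)))"
        unfolding F_def by (rule ln_mono) (use b(1) of_nat_mono[OF b(2)] in \<open>simp_all del: of_nat_power\<close>)
      also have "\<dots> = ln (real CARD('a)) * real (card (reshaped p i k))"
        by (simp add: ln_realpow)
      finally show ?thesis using b(1) by (simp add: F_def)
    qed
    note avg = dep_roots_average_tendsto[OF assms(3) F]
    define s where "s k = (\<Sum>\<^sub>\<infinity>i\<in>?I. 1 / 2 ^ (k + i + 1) * F i k)" for k
    define L where "L = (\<Sum>\<^sub>\<infinity>(k, i)\<in>root_index p. 1 / 2 ^ (k + i + 1) * F i k)"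
    have s: "((\<lambda>i. 1 / 2 ^ (k + i + 1) * F i k) has_sum s k) ?I" for k
      unfolding s_def by (rule has_sum_infsum[OF summable_on_SigmaD1[OF avg(1)]]) simp_all
    \<comment> \<open>Fubini over the reals turns the sum over pairs into the iterated sum, which is
      then transferred to \<open>ereal\<close>.\<close>
    have "(s has_sum L) UNIV"
      unfolding L_def
      by (rule has_sum_SigmaD[OF has_sum_infsum[OF avg(1)]]) (use s in \<open>simp_all only: prod.case\<close>)
    then have "s sums L" by (rule has_sum_imp_sums)
    then have "(\<lambda>k. ereal (s k)) sums ereal L" by (simp only: sums_ereal)
    moreover have "(\<Sum>\<^sub>\<infinity>i\<in>?I. ereal (1 / 2 ^ (k + i + 1)) *
        log_card (patterns (reshaped p i k) (axial_product \<Omega> X))) = ereal (s k)" for k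
    proof -
      have "ereal (1 / 2 ^ (k + i + 1)) * log_card (patterns (reshaped p i k) (axial_product \<Omega> X))
          = ereal (1 / 2 ^ (k + i + 1) * F i k)" for i
        using False by (simp add: log_card_def F_def patterns_def)
      then show ?thesis using infsumI[OF has_sum_ereal[OF s]] by simp
    qed
    ultimately have rhs: "?rhs = ereal L" by (simp add: sums_iff)
    \<comment> \<open>Gluing one fixed point of the axial product on all components shows that the
      pattern sets are nonempty, so \<open>log_card\<close> is a genuine logarithm.\<close>
    obtain x where "x \<in> mult_axial_product p \<Omega> X"
      by (rule glue_mult_axial_product[OF assms(3), of "\<lambda>_. SOME y. y \<in> axial_product \<Omega> X"])
        (use False some_in_eq in auto)
    then have ne: "patterns (ball_T n) (mult_axial_product p \<Omega> X) \<noteq> {}" for n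
      by (auto simp: patterns_def)
    have seq: "entropy_seq (mult_axial_product p \<Omega> X) n = ereal
        ((\<Sum>g | g \<in> dep_roots p \<and> length g \<le> n. F (tau F1 g) (n - length g)) / (2 ^ (n + 1) - 1))" for n
    proof -
      have "log_card (patterns (ball_T n) (mult_axial_product p \<Omega> X)) =
          ereal (\<Sum>g | g \<in> dep_roots p \<and> length g \<le> n. F (tau F1 g) (n - length g))"
        using ne by (simp add: log_card_def F_def ln_card_patterns_ball[OF assms(1,3) False])
      moreover have "(2::real) ^ (n + 1) - 1 \<noteq> 0" using ball_denominator_pos[of n] by linarith
      ultimately show ?thesis
        by (simp only: entropy_seq_def real_card_ball_T ereal_divide if_False)
    qed
    show ?thesis unfolding rhs L_def seq
      by (rule tendsto_ereal[OF avg(2)])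
  qed
  then show ?thesis unfolding tree_entropy_def by (auto intro: limI convergentI)
qed

end
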